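(* Let $x(w)$ and $y(w)$ be two holomorphic functions from $M$ into $\mathbb C$ such that $x-y\neq0$ and $x'y'\neq0$ on $M$. For these functions the system $$x_{uv}=\frac{2x_ux_v}{x-y},\qquad y_{uv}=\frac{-2y_uy_v}{x-y}\qquad(\ast)$$ becomes $$x''=\frac{2x'^2}{x-y},\qquad y''=\frac{-2y'^2}{x-y}.\qquad(\ast\ast)$$ If $x,y$ satisfy this system, then there exists a Möbius transformation $M_c(z)=\dfrac{z}{cz-1}$, with $c\in\overline{\mathbb C}$, such that $y'(w)=M_c(x'(w))$ for each $w\in M$. Conversely, if $x(w)$ and $y(w)$ are related by $y'=M_c(x')$ and $x(w)$ is a solution of the first equation of $(\ast\ast)$, then $y(w)$ is a solution of the second equation, so that $x,y$ solve the system $(\ast)$.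
   Context: $M\subset\mathbb C$ is open, connected and simply connected, with points $w=u+iv$. Subscripts $u,v$ denote partial derivatives and primes complex derivatives. $\overline{\mathbb C}=\mathbb C\cup\{\infty\}$ (with the convention $M_\infty(z)=0$). *)

theory Defs
  imports "HOL-Complex_Analysis.Complex_Analysis"
begin

definition partial_u :: "(complex \<Rightarrow> complex) \<Rightarrow> complex \<Rightarrow> complex" where
  "partial_u f w = vector_derivative (\<lambda>s. f (Complex s (Im w))) (at (Re w))"

definition partial_v :: "(complex \<Rightarrow> complex) \<Rightarrow> complex \<Rightarrow> complex" where
  "partial_v f w = vector_derivative (\<lambda>t. f (Complex (Re w) t)) (at (Im w))"

(* f_uv is read as (f_u)_v, i.e. first the derivative in u, then in v. *)

definition real_eq_x :: "complex set \<Rightarrow> (complex \<Rightarrow> complex) \<Rightarrow> (complex \<Rightarrow> complex) \<Rightarrow> bool" where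
  "real_eq_x M x y \<longleftrightarrow>
     (\<forall>w\<in>M. partial_v (partial_u x) w = 2 * partial_u x w * partial_v x w / (x w - y w))"

definition real_eq_y :: "complex set \<Rightarrow> (complex \<Rightarrow> complex) \<Rightarrow> (complex \<Rightarrow> complex) \<Rightarrow> bool" where
  "real_eq_y M x y \<longleftrightarrow>
     (\<forall>w\<in>M. partial_v (partial_u y) w = - 2 * partial_u y w * partial_v y w / (x w - y w))"

definition hol_eq_x :: "complex set \<Rightarrow> (complex \<Rightarrow> complex) \<Rightarrow> (complex \<Rightarrow> complex) \<Rightarrow> bool" where
  "hol_eq_x M x y \<longleftrightarrow>
     (\<forall>w\<in>M. deriv (deriv x) w = 2 * (deriv x w)\<^sup>2 / (x w - y w))"

definition hol_eq_y :: "complex set \<Rightarrow> (complex \<Rightarrow> complex) \<Rightarrow> (complex \<Rightarrow> complex) \<Rightarrow> bool" where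
  "hol_eq_y M x y \<longleftrightarrow>
     (\<forall>w\<in>M. deriv (deriv y) w = - 2 * (deriv y w)\<^sup>2 / (x w - y w))"

(* The extended complex plane, with None as the point at infinity: the points of the
   library's Alexandroff_compactification of the plane. *)
type_synonym ext_complex = "complex option"

(* M_c(z) = z / (c z - 1) on the extended plane: the pole z = 1/c is sent to infinity
   (not to 0, as the total division of HOL would have it), infinity is sent to 1/c
   (to infinity if c = 0), and M_infinity = 0 by convention. *)
fun moebius_M :: "ext_complex \<Rightarrow> ext_complex \<Rightarrow> ext_complex" where
  "moebius_M None _ = Some 0"
| "moebius_M (Some c) (Some z) = (if c * z = 1 then None else Some (z / (c * z - 1)))"
| "moebius_M (Some c) None = (if c = 0 then None else Some (1 / c))"

end

theory Submission
  imports Defs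
begin

text \<open>
  For a holomorphic \<open>f\<close> the chain rule along the horizontal and the vertical line through \<open>w\<close>
  gives \<open>f_u = f'\<close> and \<open>f_v = \<i> f'\<close>, hence \<open>f_uv = \<i> f''\<close>. Both sides of each real equation
  thus carry exactly one factor \<open>\<i>\<close>; cancelling it yields the holomorphic equations.

  The Moebius relation comes from passing to the reciprocals \<open>1 / x'\<close> and \<open>1 / y'\<close>. Since
  \<open>(1 / f')' = - f'' / f'\<^sup>2\<close>, the holomorphic equations are linear in them:
  \<open>(1 / x')' = - 2 / (x - y)\<close> and \<open>(1 / y')' = 2 / (x - y)\<close>. On the other hand
  \<open>y' = x' / (c x' - 1)\<close> says precisely \<open>1 / x' + 1 / y' = c\<close>. So if both equations hold, the
  sum of the reciprocals has derivative zero and is a constant \<open>c\<close> on the connected set \<open>M\<close>;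
  and if the sum is constant, each of the two equations implies the other.
\<close>

lemma partial_u_eq_field_derivative:
  assumes "(f has_field_derivative D) (at w)"
  shows "partial_u f w = D"
proof -
  have "((\<lambda>s. Complex s (Im w)) has_vector_derivative 1) (at (Re w))"
    unfolding Complex_eq by (auto intro!: derivative_eq_intros)
  then have "((f \<circ> (\<lambda>s. Complex s (Im w))) has_vector_derivative 1 * D) (at (Re w))"
    by (rule field_vector_diff_chain_at) (use assms in simp)
  then show ?thesis
    unfolding partial_u_def by (simp add: vector_derivative_at o_def)
qed

lemma partial_v_eq_field_derivative:
  assumes "(f has_field_derivative D) (at w)"
  shows "partial_v f w = \<i> * D"
proof -
  have "((\<lambda>t. Complex (Re w) t) has_vector_derivative \<i>) (at (Im w))"
    unfolding Complex_eq by (auto intro!: derivative_eq_intros)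
  then have "((f \<circ> (\<lambda>t. Complex (Re w) t)) has_vector_derivative \<i> * D) (at (Im w))"
    by (rule field_vector_diff_chain_at) (use assms in simp)
  then show ?thesis
    unfolding partial_v_def by (simp add: vector_derivative_at o_def)
qed

lemma partial_uv_holomorphic:
  assumes "open M" and "f holomorphic_on M" and "w \<in> M"
  shows "partial_v (partial_u f) w = \<i> * deriv (deriv f) w"
proof -
  have u: "partial_u f z = deriv f z" if "z \<in> M" for z
    using holomorphic_derivI[OF assms(2,1) that] by (rule partial_u_eq_field_derivative)
  have "(deriv f has_field_derivative deriv (deriv f) w) (at w)"
    using assms by (intro holomorphic_derivI holomorphic_deriv)
  then have "(partial_u f has_field_derivative deriv (deriv f) w) (at w)"
    by (rule has_field_derivative_transform_within_open[OF _ assms(1,3)]) (simp add: u)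
  then show ?thesis
    by (rule partial_v_eq_field_derivative)
qed

lemma mixed_partial_equation_iff:
  assumes "open M" and "f holomorphic_on M" and "w \<in> M"
  shows "partial_v (partial_u f) w = k * partial_u f w * partial_v f w / d
         \<longleftrightarrow> deriv (deriv f) w = k * (deriv f w)\<^sup>2 / d"
proof -
  note D = holomorphic_derivI[OF assms(2,1,3)]
  have "k * partial_u f w * partial_v f w / d = \<i> * (k * (deriv f w)\<^sup>2 / d)"
    by (simp add: partial_u_eq_field_derivative[OF D] partial_v_eq_field_derivative[OF D]
        power2_eq_square)
  then show ?thesis
    by (simp only: partial_uv_holomorphic[OF assms] mult_cancel_left) simp
qed

lemma has_field_derivative_inverse_deriv:
  assumes "open M" and "f holomorphic_on M" and "w \<in> M" and "deriv f w \<noteq> 0"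
  shows "((\<lambda>z. inverse (deriv f z)) has_field_derivative
          - (deriv (deriv f) w / (deriv f w)\<^sup>2)) (at w)"
proof -
  have "(deriv f has_field_derivative deriv (deriv f) w) (at w)"
    using assms by (intro holomorphic_derivI holomorphic_deriv)
  then show ?thesis
    using assms(4) by (auto dest: DERIV_inverse_fun simp: divide_inverse power2_eq_square)
qed

text \<open>
  Taking reciprocals turns \<open>M_c\<close> into the affine map \<open>t \<mapsto> c - t\<close>. The value \<open>c = \<infinity>\<close>
  cannot occur because it would force \<open>b = 0\<close>, and the pole \<open>c a = 1\<close> is excluded because
  \<open>b\<close> is finite.
\<close>

lemma moebius_M_iff_inverse_sum:
  assumes "a \<noteq> 0" and "b \<noteq> 0"
  shows "Some b = moebius_M e (Some a) \<longleftrightarrow> e = Some (inverse a + inverse b)"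
proof (cases e)
  case None
  then show ?thesis using assms by simp
next
  case (Some c)
  show ?thesis
  proof (cases "c * a = 1")
    case True
    then have "c = inverse a"
      using assms by (simp add: field_simps)
    then show ?thesis
      using Some True assms by simp
  next
    case False
    then have "b = a / (c * a - 1) \<longleftrightarrow> c = inverse a + inverse b"
      using assms by (simp add: field_simps)
    then show ?thesis
      using Some False by simp
  qed
qed

theorem theorem7p1:
  fixes M :: "complex set" and x y :: "complex \<Rightarrow> complex"
  assumes "open M" and "connected M" and "simply_connected M"
    and "x holomorphic_on M" and "y holomorphic_on M"
    and "\<forall>w\<in>M. x w - y w \<noteq> 0"
    and "\<forall>w\<in>M. deriv x w * deriv y w \<noteq> 0"
  shows "(real_eq_x M x y \<longleftrightarrow> hol_eq_x M x y) \<and>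
         (real_eq_y M x y \<longleftrightarrow> hol_eq_y M x y) \<and>
         (hol_eq_x M x y \<and> hol_eq_y M x y \<longrightarrow>
           (\<exists>c :: ext_complex. \<forall>w\<in>M. Some (deriv y w) = moebius_M c (Some (deriv x w)))) \<and>
         (\<forall>c :: ext_complex.
           (\<forall>w\<in>M. Some (deriv y w) = moebius_M c (Some (deriv x w))) \<and> hol_eq_x M x y \<longrightarrow>
           hol_eq_y M x y \<and> real_eq_x M x y \<and> real_eq_y M x y)"
proof -
  have nz: "deriv x w \<noteq> 0" "deriv y w \<noteq> 0" if "w \<in> M" for w
    using assms(7) that by auto
  have real_x: "real_eq_x M x y \<longleftrightarrow> hol_eq_x M x y"
    unfolding real_eq_x_def hol_eq_x_def
    by (rule ball_cong[OF refl]) (rule mixed_partial_equation_iff[OF assms(1,4)])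
  have real_y: "real_eq_y M x y \<longleftrightarrow> hol_eq_y M x y"
    unfolding real_eq_y_def hol_eq_y_def
    by (rule ball_cong[OF refl]) (rule mixed_partial_equation_iff[OF assms(1,5)])
  define g where "g = (\<lambda>w. inverse (deriv x w) + inverse (deriv y w))"
  have moebius: "Some (deriv y w) = moebius_M c (Some (deriv x w)) \<longleftrightarrow> c = Some (g w)"
    if "w \<in> M" for c w
    unfolding g_def using nz[OF that] by (rule moebius_M_iff_inverse_sum)
  have g_deriv: "(g has_field_derivative
      - (deriv (deriv x) w / (deriv x w)\<^sup>2) + - (deriv (deriv y) w / (deriv y w)\<^sup>2)) (at w)"
    if "w \<in> M" for w
    unfolding g_def
    by (intro DERIV_add has_field_derivative_inverse_deriv[OF assms(1)] assms(4,5) that nz)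
  have "\<exists>c. \<forall>w\<in>M. Some (deriv y w) = moebius_M c (Some (deriv x w))"
    if eqs: "hol_eq_x M x y" "hol_eq_y M x y"
  proof -
    have "(g has_field_derivative 0) (at w)" if "w \<in> M" for w
      using g_deriv[OF that] eqs that nz[OF that] by (simp add: hol_eq_x_def hol_eq_y_def)
    then have "g constant_on M"
      by (rule has_field_derivative_0_imp_constant_on[OF _ assms(2,1)])
    then obtain c where "\<And>w. w \<in> M \<Longrightarrow> g w = c"
      unfolding constant_on_def by blast
    then have "Some (deriv y w) = moebius_M (Some c) (Some (deriv x w))" if "w \<in> M" for w
      using that by (simp only: moebius)
    then show ?thesis
      by blast
  qed
  moreover have "hol_eq_y M x y"
    if rel: "\<forall>w\<in>M. Some (deriv y w) = moebius_M c (Some (deriv x w))" and eq: "hol_eq_x M x y"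
    for c
    unfolding hol_eq_y_def
  proof
    fix w assume w: "w \<in> M"
    have "g z = g w" if "z \<in> M" for z
      using rel[rule_format, OF that, unfolded moebius[OF that]]
        rel[rule_format, OF w, unfolded moebius[OF w]] by simp
    then have "(g has_field_derivative 0) (at w)"
      by (intro has_field_derivative_transform_within_open[OF DERIV_const[of "g w"] assms(1) w])
        (rule sym)
    then have "deriv (deriv y) w / (deriv y w)\<^sup>2 = - (deriv (deriv x) w / (deriv x w)\<^sup>2)"
      using DERIV_unique[OF g_deriv[OF w], of 0] by (simp add: algebra_simps add_eq_0_iff)
    also have "\<dots> = - 2 / (x w - y w)"
      using eq w nz[OF w] by (simp add: hol_eq_x_def)
    finally show "deriv (deriv y) w = - 2 * (deriv y w)\<^sup>2 / (x w - y w)"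
      using nz[OF w] by (simp add: field_simps)
  qed
  ultimately show ?thesis
    using real_x real_y by blast
qed

end
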